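(* Let $m>2$, let $\mathcal{A}\in\mathbb{T}_{m,n}$ be a nonsingular $\mathcal{M}$-tensor, let $b\in\mathbb{R}^n_+$ and $F(x)=\mathcal{A}x^{m-1}-b$. Let $\{x^k\}$ be an (infinite) sequence generated by Algorithm NPA (described in the context). Then $\{x^k\}$ is a decreasing sequence, $0\le x^{k+1}\le x^k$ for all $k$, and $x^k\to x^*$ as $k\to\infty$ for some $x^*\in\mathbb{R}^n_+$. In particular, for $i\in[n]$, if $b_i$ is positive, then $x^*_i$ is also positive.
   Context: Notation. $[n]=\{1,\dots,n\}$; $\mathbb{R}^n_+$ is the set of entrywise nonnegative vectors; inequalities between vectors are entrywise. $\mathbb{T}_{m,n}$ is the set of real $m$-th order $n$-dimensional tensors $\mathcal{A}=(a_{i_1\cdots i_m})$, $1\le i_1,\dots,i_m\le n$. For $x\in\mathbb{R}^n$, $(\mathcal{A}x^{m-1})_i=\sum_{i_2,\dots,i_m=1}^n a_{ii_2\cdots i_m}x_{i_2}\cdots x_{i_m}$. A number $\lambda\in\mathbb{R}$ is an eigenvalue of $\mathcal{A}$ if there is $x\in\mathbb{R}^n\setminus\{0\}$ with $(\mathcal{A}x^{m-1})_i=\lambda x_i^{m-1}$ for all $i$; $\rho(\mathcal{A})$ is the maximum modulus of the eigenvalues. $\mathcal{I}$ is the identity tensor (entries $1$ if all indices are equal, $0$ otherwise). $\mathcal{A}$ is a nonsingular $\mathcal{M}$-tensor if $\mathcal{A}=s\mathcal{I}-\mathcal{B}$ with $\mathcal{B}$ entrywise nonnegative and $s>\rho(\mathcal{B})$.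 $F'(x)$ is the Jacobian of $F$ at $x$; for $\theta\subseteq[n]$, $x_\theta$ is the sub-vector and $A_{\theta\theta}$ the principal sub-matrix indexed by $\theta$. Algorithm NPA. Choose $\delta_1,\delta_2\in(0,1)$ and a starting point $x^0\in\mathbb{R}^n_+$ with $F(x^0)\ge 0$. For $k=0,1,2,\dots$, while $F(x^k)\neq 0$, perform the following iteration: (1) Let $j\in[n]$ (depending on $k$) satisfy $F_j(x^k)=\max_{i\in[n]}F_i(x^k)$; let $I_k=\{i\in[n]:F_i(x^k)>0\}\setminus\{j\}$ and $\bar I_k=\{\ell\in[n]:F_\ell(x^k)=0\}$. (2) Set $x^{k+1}_{\bar I_k}=x^k_{\bar I_k}$. (3) Let $\bar d^k_j=-x^k_j$. For $p=0,1,2,\dots$ compute $F_j(x^k_1,\dots,x^k_{j-1},x^k_j+\delta_1^p\bar d^k_j,x^k_{j+1},\dots,x^k_n)$; at the first $p$ for which this is $\ge 0$, set $x^{k+1}_j=x^k_j+\delta_1^p\bar d^k_j$ and stop this loop. (4) Let $d^k\in\mathbb{R}^n$ with $d^k_{\bar I_k}=0$, $d^k_j=0$ and $d^k_{I_k}=-\big([F'(x^k)]_{I_kI_k}\big)^{-1}[F(x^k)]_{I_k}$. For $q=0,1,2,\dots$ compute $F_{I_k}(x^k+\delta_2^q d^k)$; at the first $q$ for which this vector is $\ge 0$, set $x^{k+1}_{I_k}=x^k_{I_k}+\delta_2^q d^k_{I_k}$ and stop this loop. (If $I_k=\emptyset$, this step is void.) *)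

theory Defs
  imports "HOL-Analysis.Analysis"
begin

text \<open>The index set \<open>[n]\<close> is a finite type \<open>'n\<close>.  A tensor of order \<open>m\<close> maps index lists to reals;
  only its values on lists of length \<open>m\<close> are entries, so the order is always passed explicitly.\<close>

type_synonym 'n tensor = "'n list \<Rightarrow> real"

text \<open>\<open>\<A>x\<^sup>m\<^sup>-\<^sup>1\<close>; the list \<open>js\<close> is \<open>(i\<^sub>2, \<dots>, i\<^sub>m)\<close>, so \<open>m \<ge> 1\<close> is intended.\<close>

definition tensor_apply :: "nat \<Rightarrow> 'n::finite tensor \<Rightarrow> real ^ 'n \<Rightarrow> real ^ 'n" where
  "tensor_apply m A x =
     (\<chi> i. \<Sum>js \<in> {js. length js = m - 1}. A (i # js) * prod_list (map (\<lambda>j. x $ j) js))"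

definition tensor_eigenvalue :: "nat \<Rightarrow> 'n::finite tensor \<Rightarrow> real \<Rightarrow> bool" where
  "tensor_eigenvalue m A l \<longleftrightarrow>
     (\<exists>x. x \<noteq> 0 \<and> (\<forall>i. tensor_apply m A x $ i = l * (x $ i) ^ (m - 1)))"

text \<open>The moduli of the eigenvalues are bounded by the largest absolute row sum, and their
  supremum is attained as soon as there is an eigenvalue.  This is the case for the entrywise
  nonnegative tensors to which the spectral radius is applied below.\<close>

definition tensor_spectral_radius :: "nat \<Rightarrow> 'n::finite tensor \<Rightarrow> real" where
  "tensor_spectral_radius m A = (SUP l \<in> {l. tensor_eigenvalue m A l}. \<bar>l\<bar>)"

definition identity_tensor :: "'n tensor" where
  "identity_tensor is = (if \<forall>i \<in> set is. \<forall>j \<in> set is. i = j then 1 else 0)"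

definition nonneg_tensor :: "nat \<Rightarrow> 'n tensor \<Rightarrow> bool" where
  "nonneg_tensor m B \<longleftrightarrow> (\<forall>is. length is = m \<longrightarrow> 0 \<le> B is)"

definition nonsingular_M_tensor :: "nat \<Rightarrow> 'n::finite tensor \<Rightarrow> bool" where
  "nonsingular_M_tensor m A \<longleftrightarrow>
     (\<exists>s B. nonneg_tensor m B \<and> s > tensor_spectral_radius m B \<and>
        (\<forall>is. length is = m \<longrightarrow> A is = s * identity_tensor is - B is))"

text \<open>The inverse of the principal submatrix \<open>A\<^sub>\<theta>\<^sub>\<theta>\<close>, stored in the \<open>\<theta> \<times> \<theta>\<close> entries of a matrix whose
  other entries are irrelevant.  As for \<^const>\<open>matrix_inv\<close>, it is arbitrary if \<open>A\<^sub>\<theta>\<^sub>\<theta>\<close> is singular.\<close>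

definition principal_inv :: "'n set \<Rightarrow> real ^ 'n ^ 'n \<Rightarrow> real ^ 'n ^ 'n::finite" where
  "principal_inv \<theta> A =
     (SOME M. \<forall>i\<in>\<theta>. \<forall>j\<in>\<theta>.
        (\<Sum>k\<in>\<theta>. A $ i $ k * M $ k $ j) = (if i = j then 1 else 0) \<and>
        (\<Sum>k\<in>\<theta>. M $ i $ k * A $ k $ j) = (if i = j then 1 else 0))"

definition first_index :: "(nat \<Rightarrow> bool) \<Rightarrow> nat \<Rightarrow> bool" where
  "first_index P p \<longleftrightarrow> P p \<and> (\<forall>r<p. \<not> P r)"

text \<open>\<open>NPA_step F \<delta>1 \<delta>2 x x'\<close>: one iteration of Algorithm NPA can lead from \<open>x\<close> to \<open>x'\<close>.  It is a
  relation because the maximizing index \<open>j\<close> need not be unique; the numbers \<open>p\<close> and \<open>q\<close> are those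
  at which the two line searches stop.\<close>

definition NPA_step ::
  "(real ^ 'n \<Rightarrow> real ^ 'n::finite) \<Rightarrow> real \<Rightarrow> real \<Rightarrow> real ^ 'n \<Rightarrow> real ^ 'n \<Rightarrow> bool" where
  "NPA_step F \<delta>1 \<delta>2 x x' \<longleftrightarrow>
     (\<exists>j I Ibar dbar p d q.
        F x $ j = Max (range (\<lambda>i. F x $ i)) \<and>
        I = {i. F x $ i > 0} - {j} \<and>
        Ibar = {l. F x $ l = 0} \<and>
        (\<forall>l\<in>Ibar. x' $ l = x $ l) \<and>
        dbar = - (x $ j) \<and>
        first_index
          (\<lambda>p. 0 \<le> F (\<chi> i. if i = j then x $ j + \<delta>1 ^ p * dbar else x $ i) $ j) p \<and>
        x' $ j = x $ j + \<delta>1 ^ p * dbar \<and>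
        (\<forall>l\<in>Ibar. d $ l = 0) \<and>
        d $ j = 0 \<and>
        (\<forall>i\<in>I. d $ i = - (\<Sum>k\<in>I. principal_inv I (jacobian F (at x)) $ i $ k * F x $ k)) \<and>
        first_index (\<lambda>q. \<forall>i\<in>I. 0 \<le> F (x + \<delta>2 ^ q *\<^sub>R d) $ i) q \<and>
        (\<forall>i\<in>I. x' $ i = x $ i + \<delta>2 ^ q * d $ i))"

text \<open>The infinite sequences generated by Algorithm NPA: the stopping test \<open>F (X k) = 0\<close> never
  succeeds.\<close>

definition NPA_sequence ::
  "(real ^ 'n \<Rightarrow> real ^ 'n::finite) \<Rightarrow> real \<Rightarrow> real \<Rightarrow> (nat \<Rightarrow> real ^ 'n) \<Rightarrow> bool" where
  "NPA_sequence F \<delta>1 \<delta>2 X \<longleftrightarrow>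
     0 \<le> X 0 \<and> 0 \<le> F (X 0) \<and>
     (\<forall>k. F (X k) \<noteq> 0 \<and> NPA_step F \<delta>1 \<delta>2 (X k) (X (Suc k)))"

end

theory Submission
  imports Defs
begin

text \<open>Each step keeps \<open>x \<ge> 0\<close> and \<open>F x \<ge> 0\<close>. By Euler's identity for homogeneous maps,
  \<open>F' x x = (m - 1) (F x + b)\<close>; since the off-diagonal entries of \<open>F' x\<close> are nonpositive, the
  block of \<open>F' x\<close> indexed by \<open>I\<close> maps \<open>x\<close> restricted to \<open>I\<close> to a positive vector, hence it is
  invertible and inverse-monotone. This gives \<open>d \<le> 0\<close> and, because \<open>m \<ge> 2\<close>, also
  \<open>x + d \<ge> 0\<close>. Finally \<open>F\<^sub>i\<close> is antitone in the variables other than \<open>x\<^sub>i\<close>, so the separate line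
  searches together preserve \<open>F \<ge> 0\<close>. In the limit \<open>F x\<^sup>* \<ge> 0\<close>, which is impossible if
  \<open>x\<^sup>*\<^sub>i = 0 < b\<^sub>i\<close>.\<close>

section \<open>Matrices with nonpositive off-diagonal entries\<close>

text \<open>Minimal ratio argument. If \<open>v\<close> had a negative entry, the least ratio
  \<open>t\<close> of \<open>v k / u k\<close> would be negative, and \<open>v - t * u\<close> would
  be nonnegative with a zero at a minimizer \<open>l\<close>. The sign pattern bounds row
  \<open>l\<close> of its image above by 0, while the image equals \<open>M v - t * M u\<close>,
  positive in row \<open>l\<close>.\<close>

lemma Z_matrix_inverse_monotone:
  fixes M :: "'a \<Rightarrow> 'a \<Rightarrow> real"
  assumes "finite I"
    and Z: "\<And>i k. i \<in> I \<Longrightarrow> k \<in> I \<Longrightarrow> i \<noteq> k \<Longrightarrow> M i k \<le> 0"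
    and u: "\<And>i. i \<in> I \<Longrightarrow> 0 \<le> u i"
    and Mu: "\<And>i. i \<in> I \<Longrightarrow> 0 < (\<Sum>k\<in>I. M i k * u k)"
    and Mv: "\<And>i. i \<in> I \<Longrightarrow> 0 \<le> (\<Sum>k\<in>I. M i k * v k)"
    and "i \<in> I"
  shows "0 \<le> v i"
proof (rule ccontr)
  assume "\<not> 0 \<le> v i"
  \<comment> \<open>At a zero of a nonnegative vector the diagonal entry drops out and only
    nonpositive terms remain. This serves twice: a zero of \<open>u\<close> would contradict
    \<open>Mu\<close>, and below it is applied to \<open>v - t * u\<close>.\<close>
  have offdiag: "(\<Sum>k\<in>I. M l k * w k) \<le> 0"
    if "l \<in> I" "w l = 0" "\<And>k. k \<in> I \<Longrightarrow> 0 \<le> w k" for l and w :: "'a \<Rightarrow> real"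
  proof (rule sum_nonpos)
    fix k assume "k \<in> I"
    then show "M l k * w k \<le> 0"
      using that Z[of l k] by (cases "k = l") (auto simp: mult_nonpos_nonneg)
  qed
  have pos: "0 < u k" if "k \<in> I" for k
    using offdiag[of k u] Mu[OF that] u that by (force simp: less_le)
  obtain l where l: "l \<in> I" and min: "\<And>k. k \<in> I \<Longrightarrow> v l / u l \<le> v k / u k"
    using arg_min_if_finite[OF \<open>finite I\<close>, of "\<lambda>k. v k / u k"] \<open>i \<in> I\<close>
    by (metis empty_iff linorder_not_less)
  define t where "t = v l / u l"
  have "t < 0"
  proof -
    have "v i / u i < 0"
      using \<open>\<not> 0 \<le> v i\<close> pos[OF \<open>i \<in> I\<close>] by (simp add: divide_neg_pos)
    then show ?thesis
      using min[OF \<open>i \<in> I\<close>] by (simp add: t_def)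
  qed
  have "(\<Sum>k\<in>I. M l k * (v k - t * u k)) \<le> 0"
  proof (rule offdiag[OF l])
    show "v l - t * u l = 0"
      using pos[OF l] by (simp add: t_def)
    show "0 \<le> v k - t * u k" if "k \<in> I" for k
      using min[OF that] pos[OF that] by (simp add: t_def pos_le_divide_eq)
  qed
  also have "(\<Sum>k\<in>I. M l k * (v k - t * u k))
      = (\<Sum>k\<in>I. M l k * v k) - t * (\<Sum>k\<in>I. M l k * u k)"
    by (simp add: sum_subtractf sum_distrib_left algebra_simps)
  also have "\<dots> > 0"
    using Mv[OF l] mult_neg_pos[OF \<open>t < 0\<close> Mu[OF l]] by linarith
  finally show False by simp
qed

text \<open>Unfolds the choice in \<open>principal_inv\<close>: injectivity of the block provides
  the two-sided inverse that \<open>SOME\<close> asks for.\<close>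

lemma principal_inv_mult:
  fixes M :: "real ^ 'n ^ 'n::finite"
  assumes inj: "\<And>v i. (\<And>i. i \<in> I \<Longrightarrow> (\<Sum>k\<in>I. M $ i $ k * v k) = 0) \<Longrightarrow> i \<in> I \<Longrightarrow> v i = 0"
    and "i \<in> I" "j \<in> I"
  shows "(\<Sum>k\<in>I. M $ i $ k * principal_inv I M $ k $ j) = (if i = j then 1 else 0)"
proof -
  \<comment> \<open>The block is padded to the block diagonal matrix with the identity outside
    \<open>I\<close>. This turns injectivity of the block into a trivial kernel of a full square
    matrix, and the \<open>I\<close> block of the inverse of \<open>E\<close> is the
    witness.\<close>
  define E :: "real ^ 'n ^ 'n" where
    "E = (\<chi> i k. if i \<in> I \<and> k \<in> I then M $ i $ k else if i = k then 1 else 0)"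
  have E_in: "(\<Sum>k\<in>UNIV. E $ i $ k * w k) = (\<Sum>k\<in>I. M $ i $ k * w k)" if "i \<in> I"
    for i and w :: "'n \<Rightarrow> real"
    using that by (intro sum.mono_neutral_cong_right) (auto simp: E_def)
  have E_in': "(\<Sum>k\<in>UNIV. w k * E $ k $ i) = (\<Sum>k\<in>I. w k * M $ k $ i)" if "i \<in> I"
    for i and w :: "'n \<Rightarrow> real"
    using that by (intro sum.mono_neutral_cong_right) (auto simp: E_def)
  have E_out: "(\<Sum>k\<in>UNIV. E $ i $ k * w k) = w i" if "i \<notin> I"
    for i and w :: "'n \<Rightarrow> real"
    using that by (simp add: E_def if_distrib[of "\<lambda>x. x * _"] cong: if_cong)
  have "v = 0" if "E *v v = 0" for v
  proof -
    have Ev: "(\<Sum>k\<in>UNIV. E $ i $ k * v $ k) = 0" for i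
      using that by (simp add: matrix_vector_mult_def vec_eq_iff)
    have "v $ i = 0" for i
    proof (cases "i \<in> I")
      case True
      then show ?thesis
        using inj[of "\<lambda>k. v $ k"] Ev E_in by metis
    next
      case False
      then show ?thesis
        using Ev E_out by metis
    qed
    then show ?thesis by (simp add: vec_eq_iff)
  qed
  then obtain N where NE: "N ** E = mat 1"
    using matrix_left_invertible_ker[of E] by blast
  then have EN: "E ** N = mat 1"
    by (simp add: matrix_left_right_inverse)
  have "\<forall>i\<in>I. \<forall>j\<in>I. (\<Sum>k\<in>I. M $ i $ k * N $ k $ j) = (if i = j then 1 else 0) \<and>
        (\<Sum>k\<in>I. N $ i $ k * M $ k $ j) = (if i = j then 1 else 0)"
  proof (intro ballI conjI)
    fix i j assume "i \<in> I" "j \<in> I"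
    show "(\<Sum>k\<in>I. M $ i $ k * N $ k $ j) = (if i = j then 1 else 0)"
      using EN E_in[OF \<open>i \<in> I\<close>, of "\<lambda>k. N $ k $ j"]
      by (simp add: matrix_matrix_mult_def mat_def vec_eq_iff)
    show "(\<Sum>k\<in>I. N $ i $ k * M $ k $ j) = (if i = j then 1 else 0)"
      using NE E_in'[OF \<open>j \<in> I\<close>, of "\<lambda>k. N $ i $ k"]
      by (simp add: matrix_matrix_mult_def mat_def vec_eq_iff)
  qed
  from someI[where P = "\<lambda>N. \<forall>i\<in>I. \<forall>j\<in>I.
        (\<Sum>k\<in>I. M $ i $ k * N $ k $ j) = (if i = j then 1 else 0) \<and>
        (\<Sum>k\<in>I. N $ i $ k * M $ k $ j) = (if i = j then 1 else 0)", OF this]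
  show ?thesis
    using assms(2,3) unfolding principal_inv_def by blast
qed

section \<open>Monomials and their derivatives\<close>

abbreviation monomial :: "'n list \<Rightarrow> real ^ 'n::finite \<Rightarrow> real" where
  "monomial js x \<equiv> prod_list (map (\<lambda>j. x $ j) js)"

text \<open>The derivative at \<open>x\<close> in direction \<open>h\<close>, by the product rule
  along the list. Repeated indices count as separate factors, so no exponents have to be
  tracked.\<close>

fun monomial_deriv :: "'n list \<Rightarrow> real ^ 'n::finite \<Rightarrow> real ^ 'n \<Rightarrow> real" where
  "monomial_deriv [] x h = 0"
| "monomial_deriv (j # js) x h = h $ j * monomial js x + x $ j * monomial_deriv js x h"

lemma has_derivative_monomial:
  "(monomial js has_derivative monomial_deriv js x) (at x)"
proof (induction js)
  case Nil
  then show ?case by (simp add: monomial_deriv.simps(1)[abs_def])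
next
  case (Cons j js)
  have "((\<lambda>x. x $ j) has_derivative (\<lambda>h. h $ j)) (at x)"
    by (rule bounded_linear.has_derivative[OF bounded_linear_vec_nth has_derivative_ident])
  from has_derivative_mult[OF this Cons.IH] show ?case
    by (simp add: add.commute)
qed

text \<open>Euler's identity for a monomial of degree \<open>length js\<close>.\<close>

lemma monomial_deriv_self: "monomial_deriv js x x = real (length js) * monomial js x"
  by (induction js) (auto simp: algebra_simps)

lemma monomial_nonneg: "0 \<le> x \<Longrightarrow> 0 \<le> monomial js x"
  by (induction js) (auto simp: less_eq_vec_def)

lemma monomial_mono:
  assumes "0 \<le> y" "y \<le> x"
  shows "monomial js y \<le> monomial js x"
proof (induction js)
  case (Cons j js)
  then show ?case
    using assms monomial_nonneg[OF assms(1), of js] order_trans[of 0 "y $ j" "x $ j"]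
    by (auto intro!: mult_mono simp: less_eq_vec_def)
qed simp

lemma monomial_deriv_nonneg: "0 \<le> x \<Longrightarrow> 0 \<le> h \<Longrightarrow> 0 \<le> monomial_deriv js x h"
  by (induction js) (auto simp: less_eq_vec_def monomial_nonneg)

text \<open>Treats the diagonal monomial, a power of \<open>x $ i\<close>, whose coefficient may be
  positive.\<close>

lemma monomial_deriv_replicate: "h $ i = 0 \<Longrightarrow> monomial_deriv (replicate n i) x h = 0"
  by (induction n) auto

section \<open>Tensors with nonpositive off-diagonal entries\<close>

text \<open>The tensor analogue of a Z-matrix; \<open>replicate (m - 1) i\<close> is the tail of the
  diagonal index \<open>(i, ..., i)\<close>.\<close>

definition Z_tensor :: "nat \<Rightarrow> 'n tensor \<Rightarrow> bool" where
  "Z_tensor m A \<longleftrightarrow>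
     (\<forall>i js. length js = m - 1 \<longrightarrow> js \<noteq> replicate (m - 1) i \<longrightarrow> A (i # js) \<le> 0)"

lemma Z_tensor_nonsingular_M_tensor:
  fixes A :: "'n::finite tensor"
  assumes "nonsingular_M_tensor m A" "0 < m"
  shows "Z_tensor m A"
  unfolding Z_tensor_def
proof (intro allI impI)
  fix i and js :: "'n list"
  assume js: "length js = m - 1" "js \<noteq> replicate (m - 1) i"
  obtain s B where "nonneg_tensor m B"
    and "\<forall>is. length is = m \<longrightarrow> A is = s * identity_tensor is - B is"
    using assms(1) by (auto simp: nonsingular_M_tensor_def)
  moreover have "identity_tensor (i # js) = 0"
    using js replicate_eqI[of js "m - 1" i] by (auto simp: identity_tensor_def)
  ultimately show "A (i # js) \<le> 0"
    using js \<open>0 < m\<close> by (simp add: nonneg_tensor_def)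
qed

text \<open>The diagonal term depends on coordinate \<open>i\<close> alone, where \<open>x\<close>
  and \<open>y\<close> agree. Every other term is a nonpositive coefficient times a monomial that is
  monotone on nonnegative vectors.\<close>

lemma tensor_apply_antitone_off_diagonal:
  fixes A :: "'n::finite tensor"
  assumes "Z_tensor m A" "0 \<le> y" "y \<le> x" "y $ i = x $ i"
  shows "tensor_apply m A x $ i \<le> tensor_apply m A y $ i"
  unfolding tensor_apply_def vec_lambda_beta
proof (rule sum_mono)
  fix js assume js: "js \<in> {js :: 'n list. length js = m - 1}"
  show "A (i # js) * monomial js x \<le> A (i # js) * monomial js y"
  proof (cases "js = replicate (m - 1) i")
    case True
    then show ?thesis using assms(4) by simp
  next
    case False
    then show ?thesis
      using assms js monomial_mono[of y x js]
      by (intro mult_left_mono_neg) (auto simp: Z_tensor_def)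
  qed
qed

text \<open>Comparison with the zero vector, which agrees with \<open>x\<close> at \<open>i\<close>.
  By \<open>1 < m\<close> every monomial has positive degree and vanishes there.\<close>

lemma tensor_apply_nonpos:
  fixes A :: "'n::finite tensor"
  assumes "Z_tensor m A" "1 < m" "0 \<le> x" "x $ i = 0"
  shows "tensor_apply m A x $ i \<le> 0"
proof -
  have "tensor_apply m A x $ i \<le> tensor_apply m A 0 $ i"
    using assms by (intro tensor_apply_antitone_off_diagonal) auto
  also have "tensor_apply m A 0 $ i = 0"
    unfolding tensor_apply_def vec_lambda_beta
  proof (rule sum.neutral, rule ballI)
    fix js assume "js \<in> {js :: 'n list. length js = m - 1}"
    then show "A (i # js) * monomial js 0 = 0"
      using \<open>1 < m\<close> by (cases js) auto
  qed
  finally show ?thesis .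
qed

section \<open>The derivative of the tensor map and Euler's identity\<close>

definition tensor_deriv :: "nat \<Rightarrow> 'n::finite tensor \<Rightarrow> real ^ 'n \<Rightarrow> real ^ 'n \<Rightarrow> real ^ 'n" where
  "tensor_deriv m A x h =
     (\<chi> i. \<Sum>js \<in> {js. length js = m - 1}. A (i # js) * monomial_deriv js x h)"

lemma has_derivative_tensor_apply:
  "(tensor_apply m A has_derivative tensor_deriv m A x) (at x)"
  by (subst has_derivative_componentwise_within)
    (auto simp: Basis_vec_def inner_axis tensor_apply_def tensor_deriv_def
      intro!: has_derivative_sum has_derivative_mult_right has_derivative_monomial)

lemma tensor_deriv_self: "tensor_deriv m A x x = real (m - 1) *\<^sub>R tensor_apply m A x"
  by (auto simp: tensor_deriv_def tensor_apply_def monomial_deriv_self vec_eq_iff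
      sum_distrib_left intro!: sum.cong)

text \<open>Infinitesimal form of the antitonicity above. For \<open>h\<close> a unit vector other
  than the \<open>i\<close>-th it gives the sign of the off-diagonal Jacobian entries.\<close>

lemma tensor_deriv_off_diagonal:
  fixes A :: "'n::finite tensor"
  assumes "Z_tensor m A" "0 \<le> x" "0 \<le> h" "h $ i = 0"
  shows "tensor_deriv m A x h $ i \<le> 0"
  unfolding tensor_deriv_def vec_lambda_beta
proof (rule sum_nonpos)
  fix js assume js: "js \<in> {js :: 'n list. length js = m - 1}"
  show "A (i # js) * monomial_deriv js x h \<le> 0"
  proof (cases "js = replicate (m - 1) i")
    case True
    then show ?thesis using assms(4) by (simp add: monomial_deriv_replicate)
  next
    case False
    then show ?thesis
      using assms js monomial_deriv_nonneg[of x h js]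
      by (auto simp: Z_tensor_def intro!: mult_nonpos_nonneg)
  qed
qed

section \<open>The iteration\<close>

text \<open>On \<open>I\<close> the Newton equation reads \<open>J d = - F x\<close>, and Euler's
  identity gives \<open>J x \<ge> F x > 0\<close> for the block. So \<open>x\<close> is the positive
  test vector for inverse monotonicity, which is applied to \<open>- d\<close> and to
  \<open>x + d\<close>, whose images are \<open>F x\<close> and at least 0.\<close>

lemma newton_direction_bounds:
  fixes m :: nat and A :: "'n::finite tensor" and b x d :: "real ^ 'n"
  defines "F \<equiv> \<lambda>x. tensor_apply m A x - b"
  assumes Z: "Z_tensor m A" and "1 < m" and "0 \<le> b" and "0 \<le> x"
    and FI: "\<And>i. i \<in> I \<Longrightarrow> 0 < F x $ i"
    and d: "\<And>i. i \<in> I \<Longrightarrow>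
      d $ i = - (\<Sum>k\<in>I. principal_inv I (jacobian F (at x)) $ i $ k * F x $ k)"
    and "i \<in> I"
  shows "d $ i \<le> 0" "0 \<le> x $ i + d $ i"
proof -
  define J where "J = jacobian F (at x)"
  have der: "(F has_derivative tensor_deriv m A x) (at x)"
    using has_derivative_diff[OF has_derivative_tensor_apply has_derivative_const]
    by (simp add: F_def)
  have "(F has_derivative (\<lambda>h. J *v h)) (at x)"
    using der jacobian_works[of F "at x"] by (auto simp: J_def differentiable_def)
  then have J: "J *v h = tensor_deriv m A x h" for h
    using has_derivative_unique[OF der] by metis
  have J_off: "J $ i $ k \<le> 0" if "i \<noteq> k" for i k
  proof -
    have "J $ i $ k = tensor_deriv m A x (axis k 1) $ i"
      by (simp add: J[symmetric] matrix_vector_mult_basis column_def)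
    also have "\<dots> \<le> 0"
      using that by (intro tensor_deriv_off_diagonal[OF Z \<open>0 \<le> x\<close>])
        (auto simp: less_eq_vec_def axis_def)
    finally show ?thesis .
  qed
  have Jx: "F x $ i \<le> (\<Sum>k\<in>I. J $ i $ k * x $ k)" if "i \<in> I" for i
  proof -
    \<comment> \<open>Since \<open>i\<close> lies in \<open>I\<close>, the columns outside
      \<open>I\<close> meet row \<open>i\<close> only off the diagonal, so discarding them can only
      increase the sum.\<close>
    have off: "(\<Sum>k\<in>-I. J $ i $ k * x $ k) \<le> 0"
    proof (rule sum_nonpos)
      fix k assume "k \<in> - I"
      then have "J $ i $ k \<le> 0"
        using J_off[of i k] that by auto
      then show "J $ i $ k * x $ k \<le> 0"
        using \<open>0 \<le> x\<close> by (simp add: less_eq_vec_def mult_nonpos_nonneg)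
    qed
    have "F x $ i \<le> 1 * (F x $ i + b $ i)"
      using \<open>0 \<le> b\<close> by (simp add: less_eq_vec_def)
    \<comment> \<open>The Euler factor \<open>m - 1\<close> is at least 1 and
      \<open>F x $ i + b $ i\<close> is nonnegative.\<close>
    also have "\<dots> \<le> real (m - 1) * (F x $ i + b $ i)"
      using \<open>1 < m\<close> FI[OF that] \<open>0 \<le> b\<close>
      by (intro mult_right_mono) (auto simp: less_eq_vec_def less_imp_le)
    also have "\<dots> = (J *v x) $ i"
      by (simp add: J tensor_deriv_self F_def)
    also have "\<dots> = (\<Sum>k\<in>UNIV. J $ i $ k * x $ k)"
      by (simp add: matrix_vector_mult_def)
    also have "\<dots> = (\<Sum>k\<in>I. J $ i $ k * x $ k) + (\<Sum>k\<in>-I. J $ i $ k * x $ k)"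
      by (subst sum.union_disjoint[symmetric]) (auto intro: sum.cong)
    also have "\<dots> \<le> (\<Sum>k\<in>I. J $ i $ k * x $ k)"
      using off by simp
    finally show ?thesis .
  qed
  have mono: "0 \<le> v i"
    if "\<And>i. i \<in> I \<Longrightarrow> 0 \<le> (\<Sum>k\<in>I. J $ i $ k * v k)" "i \<in> I" for v i
  proof (rule Z_matrix_inverse_monotone[of I "\<lambda>i k. J $ i $ k" "\<lambda>k. x $ k"])
    show "0 < (\<Sum>k\<in>I. J $ i $ k * x $ k)" if "i \<in> I" for i
      using FI[OF that] Jx[OF that] by linarith
  qed (use that J_off \<open>0 \<le> x\<close> in \<open>auto simp: less_eq_vec_def\<close>)
  \<comment> \<open>A kernel vector and its negative are both nonnegative by
    \<open>mono\<close>.\<close>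
  have inj: "v i = 0" if "\<And>i. i \<in> I \<Longrightarrow> (\<Sum>k\<in>I. J $ i $ k * v k) = 0" "i \<in> I" for v i
    using mono[of v i] mono[of "\<lambda>k. - v k" i] that by (simp add: sum_negf)
  have JP: "(\<Sum>k\<in>I. J $ i $ k * principal_inv I J $ k $ l) = (if i = l then 1 else 0)"
    if "i \<in> I" "l \<in> I" for i l
    by (rule principal_inv_mult[OF _ that]) (rule inj)
  have Jd: "(\<Sum>k\<in>I. J $ i $ k * d $ k) = - F x $ i" if "i \<in> I" for i
  proof -
    have "(\<Sum>k\<in>I. J $ i $ k * d $ k)
        = - (\<Sum>k\<in>I. \<Sum>l\<in>I. J $ i $ k * principal_inv I J $ k $ l * F x $ l)"
      using d by (simp add: J_def sum_negf sum_distrib_left mult.assoc)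
    also have "(\<Sum>k\<in>I. \<Sum>l\<in>I. J $ i $ k * principal_inv I J $ k $ l * F x $ l)
        = (\<Sum>l\<in>I. (\<Sum>k\<in>I. J $ i $ k * principal_inv I J $ k $ l) * F x $ l)"
      by (subst sum.swap) (simp add: sum_distrib_right)
    also have "\<dots> = (\<Sum>l\<in>I. (if i = l then 1 else 0) * F x $ l)"
      using JP[OF that] by (intro sum.cong) auto
    also have "\<dots> = F x $ i"
      using that by (simp add: if_distrib[of "\<lambda>y. y * _"] cong: if_cong)
    finally show ?thesis by simp
  qed
  show "d $ i \<le> 0"
    using mono[of "\<lambda>k. - d $ k" i] Jd FI \<open>i \<in> I\<close> by (simp add: sum_negf less_imp_le)
  show "0 \<le> x $ i + d $ i"
    using mono[of "\<lambda>k. x $ k + d $ k" i] Jd Jx \<open>i \<in> I\<close>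
    by (simp add: distrib_left sum.distrib)
qed

text \<open>Each component \<open>i\<close> of \<open>F\<close> is known to be nonnegative at a
  point above \<open>x'\<close> with the same \<open>i\<close>-th coordinate: the tested point
  \<open>z\<close> for \<open>j\<close>, the tested point \<open>y\<close> for \<open>I\<close>, and
  \<open>x\<close> itself where \<open>F x\<close> vanishes. Antitonicity carries the sign over to
  \<open>x'\<close>.\<close>

lemma NPA_step_invariant:
  fixes m :: nat and A :: "'n::finite tensor" and b x x' :: "real ^ 'n"
  defines "F \<equiv> \<lambda>x. tensor_apply m A x - b"
  assumes Z: "Z_tensor m A" and "1 < m" and "0 \<le> b" and "0 \<le> x" and "0 \<le> F x" and "F x \<noteq> 0"
    and \<delta>: "0 < \<delta>1" "\<delta>1 < 1" "0 < \<delta>2" "\<delta>2 < 1"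
    and step: "NPA_step F \<delta>1 \<delta>2 x x'"
  shows "0 \<le> x'" "x' \<le> x" "0 \<le> F x'"
proof -
  obtain j I d p q where
    j: "F x $ j = Max (range (\<lambda>i. F x $ i))" and
    I: "I = {i. F x $ i > 0} - {j}" and
    x'_bar: "\<And>l. F x $ l = 0 \<Longrightarrow> x' $ l = x $ l" and
    p: "first_index
          (\<lambda>p. 0 \<le> F (\<chi> i. if i = j then x $ j + \<delta>1 ^ p * - (x $ j) else x $ i) $ j) p" and
    x'_j: "x' $ j = x $ j + \<delta>1 ^ p * - (x $ j)" and
    d_bar: "\<And>l. F x $ l = 0 \<Longrightarrow> d $ l = 0" and
    d_j: "d $ j = 0" and
    d_I: "\<And>i. i \<in> I \<Longrightarrow>
      d $ i = - (\<Sum>k\<in>I. principal_inv I (jacobian F (at x)) $ i $ k * F x $ k)" and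
    q: "first_index (\<lambda>q. \<forall>i\<in>I. 0 \<le> F (x + \<delta>2 ^ q *\<^sub>R d) $ i) q" and
    x'_I: "\<And>i. i \<in> I \<Longrightarrow> x' $ i = x $ i + \<delta>2 ^ q * d $ i"
    using step unfolding NPA_step_def by blast
  define t where "t = \<delta>2 ^ q"
  define y where "y = x + t *\<^sub>R d"
  define z where "z = (\<chi> i. if i = j then x $ j + \<delta>1 ^ p * - (x $ j) else x $ i)"
  have t: "0 \<le> t" "t \<le> 1"
    using \<delta> by (auto simp: t_def power_le_one)
  have Fnn: "0 \<le> F x $ i" for i
    using \<open>0 \<le> F x\<close> by (simp add: less_eq_vec_def)
  have xnn: "0 \<le> x $ i" for i
    using \<open>0 \<le> x\<close> by (simp add: less_eq_vec_def)
  have "F x $ j > 0"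
  proof -
    obtain i where "F x $ i \<noteq> 0"
      using \<open>F x \<noteq> 0\<close> by (auto simp: vec_eq_iff)
    moreover have "F x $ i \<le> F x $ j"
      unfolding j by (rule Max_ge) auto
    ultimately show ?thesis
      using Fnn[of i] by linarith
  qed
  have cover: "i = j \<or> i \<in> I \<or> F x $ i = 0" for i
    using Fnn[of i] by (auto simp: I less_le)
  have dir: "d $ i \<le> 0" "0 \<le> x $ i + d $ i" if "i \<in> I" for i
    using newton_direction_bounds[of m A b x I d i] Z \<open>1 < m\<close> \<open>0 \<le> b\<close> \<open>0 \<le> x\<close> d_I that
    by (auto simp: F_def I)
  have "d $ i \<le> 0" "0 \<le> x $ i + d $ i" for i
    using cover[of i] dir[of i] d_bar[of i] d_j xnn[of i] by auto
  then have yx: "y $ i \<le> x $ i" and y0: "0 \<le> y $ i" for i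
  proof -
    show "y $ i \<le> x $ i"
      using t \<open>\<And>i. d $ i \<le> 0\<close> by (simp add: y_def mult_nonneg_nonpos)
    \<comment> \<open>A convex combination of the old coordinate and the full Newton step, both
      nonnegative.\<close>
    have "y $ i = (1 - t) * x $ i + t * (x $ i + d $ i)"
      by (simp add: y_def algebra_simps)
    then show "0 \<le> y $ i"
      using t xnn \<open>\<And>i. 0 \<le> x $ i + d $ i\<close> by simp
  qed
  have x'_y: "x' $ i = y $ i" if "i \<noteq> j" for i
    using cover[of i] that x'_I[of i] x'_bar[of i] d_bar[of i] by (auto simp: y_def t_def)
  have x'_z: "x' $ j = z $ j"
    by (simp add: z_def x'_j)
  have zj: "0 \<le> z $ j" "z $ j \<le> x $ j"
  proof -
    have "0 \<le> \<delta>1 ^ p" "\<delta>1 ^ p \<le> 1"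
      using \<delta> by (auto simp: power_le_one)
    then show "0 \<le> z $ j" "z $ j \<le> x $ j"
      using xnn[of j] mult_left_le_one_le[of "x $ j" "\<delta>1 ^ p"] by (auto simp: z_def)
  qed
  show x'0: "0 \<le> x'"
    unfolding less_eq_vec_def using x'_y x'_z zj y0 by (metis zero_index)
  show x'x: "x' \<le> x"
    unfolding less_eq_vec_def using x'_y x'_z zj yx by metis
  \<comment> \<open>The second line search leaves coordinate \<open>j\<close> at its old value, so
    the decrease of \<open>x'\<close> in \<open>j\<close> gives \<open>x' \<le> y\<close>.\<close>
  have "y $ j = x $ j"
    by (simp add: y_def d_j)
  then have "x' \<le> y"
    unfolding less_eq_vec_def using x'_y x'_z zj by (metis order_refl)
  have "x' \<le> z"
    using x'x x'_z by (auto simp: less_eq_vec_def z_def)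
  have F_antitone: "F w $ i \<le> F x' $ i" if "x' \<le> w" "x' $ i = w $ i" for w i
    using tensor_apply_antitone_off_diagonal[OF Z x'0 that] by (simp add: F_def)
  have "0 \<le> F x' $ i" for i
    using cover[of i]
  proof (elim disjE)
    assume "i = j"
    then show ?thesis
      using F_antitone[OF \<open>x' \<le> z\<close> x'_z] p by (auto simp: first_index_def z_def)
  next
    assume "i \<in> I"
    then have "0 \<le> F y $ i" "i \<noteq> j"
      using q by (auto simp: first_index_def y_def t_def I)
    then show ?thesis
      using F_antitone[OF \<open>x' \<le> y\<close> x'_y[of i]] by simp
  next
    assume "F x $ i = 0"
    then show ?thesis
      using F_antitone[OF x'x, of i] x'_bar[of i] by simp
  qed
  then show "0 \<le> F x'"
    by (simp add: less_eq_vec_def)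
qed

section \<open>Convergence of the iterates\<close>

lemma decseq_vec_convergent:
  fixes X :: "nat \<Rightarrow> real ^ 'n::finite"
  assumes "decseq X" "\<And>k. c \<le> X k"
  obtains l where "X \<longlonglongrightarrow> l" "c \<le> l"
proof -
  have "\<exists>l. (\<lambda>k. X k $ i) \<longlonglongrightarrow> l \<and> c $ i \<le> l" for i
  proof -
    have dec: "decseq (\<lambda>k. X k $ i)" and bound: "\<And>k. c $ i \<le> X k $ i"
      using decseqD[OF assms(1)] assms(2) by (auto simp: decseq_def less_eq_vec_def)
    obtain l where l: "(\<lambda>k. X k $ i) \<longlonglongrightarrow> l"
      using decseq_convergent[OF dec, of "c $ i"] bound by blast
    have "c $ i \<le> l"
      by (rule LIMSEQ_le_const[OF l]) (use bound in blast)
    with l show ?thesis by blast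
  qed
  then obtain l where l: "\<And>i. (\<lambda>k. X k $ i) \<longlonglongrightarrow> l i" "\<And>i. c $ i \<le> l i"
    by metis
  show thesis
  proof (rule that)
    show "X \<longlonglongrightarrow> (\<chi> i. l i)"
      by (rule vec_tendstoI) (simp add: l)
    show "c \<le> (\<chi> i. l i)"
      by (simp add: less_eq_vec_def l)
  qed
qed

theorem theorem3p1:
  fixes A :: "'n::finite tensor" and b :: "real ^ 'n"
    and F :: "real ^ 'n \<Rightarrow> real ^ 'n" and m :: nat
    and \<delta>1 \<delta>2 :: real and X :: "nat \<Rightarrow> real ^ 'n"
  assumes "m > 2"
    and "nonsingular_M_tensor m A"
    and "0 \<le> b"
    and "F = (\<lambda>x. tensor_apply m A x - b)"
    and "0 < \<delta>1" "\<delta>1 < 1" "0 < \<delta>2" "\<delta>2 < 1"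
    and "NPA_sequence F \<delta>1 \<delta>2 X"
  shows "decseq X \<and>
    (\<forall>k. 0 \<le> X (Suc k) \<and> X (Suc k) \<le> X k) \<and>
    (\<exists>xstar. 0 \<le> xstar \<and> X \<longlonglongrightarrow> xstar \<and> (\<forall>i. b $ i > 0 \<longrightarrow> xstar $ i > 0))"
proof -
  have Z: "Z_tensor m A"
    using assms(1,2) by (intro Z_tensor_nonsingular_M_tensor) auto
  have "1 < m"
    using assms(1) by simp
  have start: "0 \<le> X 0" "0 \<le> F (X 0)"
    and iter: "\<And>k. F (X k) \<noteq> 0" "\<And>k. NPA_step F \<delta>1 \<delta>2 (X k) (X (Suc k))"
    using assms(9) by (auto simp: NPA_sequence_def)
  have step: "0 \<le> X (Suc k) \<and> X (Suc k) \<le> X k \<and> 0 \<le> F (X (Suc k))"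
    if "0 \<le> X k \<and> 0 \<le> F (X k)" for k
    using NPA_step_invariant[OF Z \<open>1 < m\<close> assms(3), of "X k" \<delta>1 \<delta>2 "X (Suc k)"]
      iter[of k] assms(5-8) that unfolding assms(4) by blast
  have inv: "0 \<le> X k \<and> 0 \<le> F (X k)" for k
    by (induction k) (use start step in auto)
  have dec: "X (Suc k) \<le> X k" for k
    using step inv by blast
  then have "decseq X"
    by (simp add: decseq_Suc_iff)
  then obtain l where l: "X \<longlonglongrightarrow> l" "0 \<le> l"
    using decseq_vec_convergent[of X 0] inv by blast
  have "0 < l $ i" if "b $ i > 0" for i
  proof (rule ccontr)
    assume "\<not> 0 < l $ i"
    then have "l $ i = 0"
      using l(2) by (auto simp: less_eq_vec_def intro: antisym)
    \<comment> \<open>By continuity the bound \<open>0 \<le> F (X k)\<close>, that is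
      \<open>b \<le> tensor_apply m A (X k)\<close>, passes to the limit; at a zero coordinate of
      \<open>l\<close> it would force \<open>b $ i \<le> 0\<close>.\<close>
    have "(\<lambda>k. tensor_apply m A (X k) $ i) \<longlonglongrightarrow> tensor_apply m A l $ i"
      using has_derivative_continuous[OF has_derivative_tensor_apply] l(1)
      by (intro tendsto_vec_nth isCont_tendsto_compose[of l "tensor_apply m A"])
    moreover have "b $ i \<le> tensor_apply m A (X k) $ i" for k
      using inv[of k] by (simp add: assms(4) less_eq_vec_def)
    ultimately have "b $ i \<le> tensor_apply m A l $ i"
      by (intro LIMSEQ_le_const) auto
    then show False
      using tensor_apply_nonpos[OF Z \<open>1 < m\<close> l(2) \<open>l $ i = 0\<close>] that by linarith
  qed
  then show ?thesis
    using \<open>decseq X\<close> inv dec l by blast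
qed

end
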